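(* For every integer $k\ge 1$, the graph $K_{k,k}\,\Delta\, M_k$ (which has order $2k$) contains at least $2^{k-1}$ minimal local sets.
   Context: $K_{k,k}\Delta M_k$ denotes the symmetric difference (on edges) of a complete bipartite graph and a perfect matching: it is the simple undirected graph with vertex set $\{u_0,\dots,u_{k-1}\}\cup\{v_0,\dots,v_{k-1}\}$ ($2k$ distinct vertices) in which $u_i$ and $v_j$ are adjacent if and only if $i\ne j$, and no two $u_i$'s and no two $v_j$'s are adjacent. For a finite simple undirected graph $G=(V,E)$ and $D\subseteq V$, the odd neighborhood of $D$ is $Odd_G(D)=\{v\in V : |N_G(v)\cap D| \equiv 1 \pmod 2\}$, where $N_G(v)$ is the set of neighbors of $v$. A local set of $G$ is a non-empty subset $L\subseteq V$ of the form $L=D\cup Odd_G(D)$ for some $D\subseteq V$. A minimal local set is a local set that is minimal by inclusion among local sets. *)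

theory Defs
  imports Main
begin

text \<open>Undirected graphs are given by a vertex set \<open>V\<close> and a set \<open>E\<close> of two-element subsets of \<open>V\<close>.\<close>

definition finite_simple_graph :: "'a set \<Rightarrow> 'a set set \<Rightarrow> bool" where
  "finite_simple_graph V E \<longleftrightarrow> finite V \<and> (\<forall>e\<in>E. e \<subseteq> V \<and> card e = 2)"

definition neighbors :: "'a set \<Rightarrow> 'a set set \<Rightarrow> 'a \<Rightarrow> 'a set" where
  "neighbors V E v = {w \<in> V. {v, w} \<in> E}"

definition odd_neighborhood :: "'a set \<Rightarrow> 'a set set \<Rightarrow> 'a set \<Rightarrow> 'a set" where
  "odd_neighborhood V E D = {v \<in> V. odd (card (neighbors V E v \<inter> D))}"

definition local_set :: "'a set \<Rightarrow> 'a set set \<Rightarrow> 'a set \<Rightarrow> bool" where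
  "local_set V E L \<longleftrightarrow> L \<noteq> {} \<and> (\<exists>D\<subseteq>V. L = D \<union> odd_neighborhood V E D)"

definition minimal_local_set :: "'a set \<Rightarrow> 'a set set \<Rightarrow> 'a set \<Rightarrow> bool" where
  "minimal_local_set V E L \<longleftrightarrow>
     local_set V E L \<and> (\<forall>L'. local_set V E L' \<and> L' \<subseteq> L \<longrightarrow> L' = L)"

text \<open>The vertex \<open>u\<^sub>i\<close> is \<^term>\<open>Inl i\<close> and the vertex \<open>v\<^sub>j\<close> is \<^term>\<open>Inr j\<close>.\<close>

definition bip_verts :: "nat \<Rightarrow> (nat + nat) set" where
  "bip_verts k = Inl ` {..<k} \<union> Inr ` {..<k}"

definition complete_bip_edges :: "nat \<Rightarrow> (nat + nat) set set" where
  "complete_bip_edges k = {{Inl i, Inr j} | i j. i < k \<and> j < k}"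

definition matching_edges :: "nat \<Rightarrow> (nat + nat) set set" where
  "matching_edges k = {{Inl i, Inr i} | i. i < k}"

definition bip_diff_matching_edges :: "nat \<Rightarrow> (nat + nat) set set" where
  "bip_diff_matching_edges k = sym_diff (complete_bip_edges k) (matching_edges k)"

lemma bip_diff_matching_edges_eq:
  "bip_diff_matching_edges k = {{Inl i, Inr j} | i j. i < k \<and> j < k \<and> i \<noteq> j}"
proof -
  have *: "{Inl i, Inr j} \<in> matching_edges k \<longleftrightarrow> i < k \<and> i = j" for i j
    unfolding matching_edges_def by (auto simp: doubleton_eq_iff)
  have "matching_edges k \<subseteq> complete_bip_edges k"
    unfolding matching_edges_def complete_bip_edges_def by blast
  then have "bip_diff_matching_edges k = complete_bip_edges k - matching_edges k"
    unfolding bip_diff_matching_edges_def by blast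
  also have "\<dots> = {{Inl i, Inr j} | i j. i < k \<and> j < k \<and> {Inl i, Inr j} \<notin> matching_edges k}"
    unfolding complete_bip_edges_def by blast
  also have "\<dots> = {{Inl i, Inr j} | i j. i < k \<and> j < k \<and> i \<noteq> j}"
    unfolding * by metis
  finally show ?thesis .
qed

lemma bip_diff_matching_adjacency:
  "{Inl i, Inr j} \<in> bip_diff_matching_edges k \<longleftrightarrow> i < k \<and> j < k \<and> i \<noteq> j"
  "{Inl i, Inl j} \<notin> bip_diff_matching_edges k"
  "{Inr i, Inr j} \<notin> bip_diff_matching_edges k"
  unfolding bip_diff_matching_edges_eq by (simp_all add: doubleton_eq_iff)

lemma finite_simple_graph_bip_diff_matching:
  "finite_simple_graph (bip_verts k) (bip_diff_matching_edges k)"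
  unfolding finite_simple_graph_def bip_verts_def bip_diff_matching_edges_eq by auto

end

(* For an index set A of odd size, let L(A) consist of the u_i with i in A and the v_j with j not
   in A; this is D \<union> Odd(D) for D = {u_i : i in A}. A local set inside L(A) is generated by some
   {u_i : i in B} \<union> {v_j : j in C} with B in A and C outside A. If B has even size, then
   Odd contains v_j for every j in B, so B is empty; if B has odd size, then Odd contains v_j
   for every j not in B, so B = A and the local set is all of L(A). The same holds for C. *)

theory Submission
  imports Defs
begin

definition split_set :: "nat \<Rightarrow> nat set \<Rightarrow> (nat + nat) set" where
  "split_set k A = Inl ` A \<union> Inr ` ({..<k} - A)"

lemma odd_card_Diff_singleton_iff:
  assumes "finite A"
  shows "odd (card (A - {x})) \<longleftrightarrow> (odd (card A) \<longleftrightarrow> x \<notin> A)"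
proof (cases "x \<in> A")
  case True
  then show ?thesis
    using card_Suc_Diff1[OF assms True] by (metis even_Suc)
qed simp

text \<open>Inside the set, \<open>Inl i\<close> is adjacent to exactly the \<open>Inr j\<close>
  with \<open>j\<close> in \<open>C - {i}\<close>. The parity of that count is the parity of
  \<open>card C\<close>, flipped precisely when \<open>i\<close> lies in \<open>C\<close>; the other
  side is symmetric.\<close>

lemma odd_neighborhood_bip_diff_matching:
  assumes B: "B \<subseteq> {..<k}" and C: "C \<subseteq> {..<k}"
  shows "odd_neighborhood (bip_verts k) (bip_diff_matching_edges k) (Inl ` B \<union> Inr ` C) =
    Inl ` {i. i < k \<and> (odd (card C) \<longleftrightarrow> i \<notin> C)} \<union> Inr ` {j. j < k \<and> (odd (card B) \<longleftrightarrow> j \<notin> B)}"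
    (is "?O = ?R")
proof -
  let ?N = "\<lambda>x. neighbors (bip_verts k) (bip_diff_matching_edges k) x \<inter> (Inl ` B \<union> Inr ` C)"
  have fin: "finite B" "finite C"
    using B C finite_subset by blast+
  have "?N (Inl i) = Inr ` (C - {i})" if "i < k" for i
    using that C
    by (auto simp: neighbors_def bip_verts_def bip_diff_matching_adjacency)
  moreover have "?N (Inr j) = Inl ` (B - {j})" if "j < k" for j
    using that B
    by (auto simp: neighbors_def bip_verts_def bip_diff_matching_adjacency insert_commute)
  ultimately have card_N: "i < k \<Longrightarrow> card (?N (Inl i)) = card (C - {i})"
    "i < k \<Longrightarrow> card (?N (Inr i)) = card (B - {i})" for i
    by (simp_all add: card_image)
  have verts: "Inl i \<in> bip_verts k \<longleftrightarrow> i < k" "Inr i \<in> bip_verts k \<longleftrightarrow> i < k" for i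
    by (auto simp: bip_verts_def)
  show ?thesis
  proof (rule set_eqI)
    fix x show "x \<in> ?O \<longleftrightarrow> x \<in> ?R"
      by (cases x) (auto simp: odd_neighborhood_def verts card_N
          odd_card_Diff_singleton_iff fin image_iff)
  qed
qed

lemma minimal_local_set_split_set:
  assumes A: "A \<subseteq> {..<k}" and odd: "odd (card A)"
  shows "minimal_local_set (bip_verts k) (bip_diff_matching_edges k) (split_set k A)"
  unfolding minimal_local_set_def
proof (intro conjI allI impI)
  let ?Odd = "odd_neighborhood (bip_verts k) (bip_diff_matching_edges k)"
  have "A \<noteq> {}"
    using odd by auto
  moreover have "Inl ` A \<subseteq> bip_verts k"
    using A by (auto simp: bip_verts_def)
  \<comment> \<open>Taking \<open>C = {}\<close> adds no vertex on the \<open>Inl\<close> side, and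
    since \<open>card A\<close> is odd, the \<open>Inr\<close> side is the complement of
    \<open>A\<close>.\<close>
  moreover have "split_set k A = Inl ` A \<union> ?Odd (Inl ` A)"
    using odd_neighborhood_bip_diff_matching[OF A, of "{}"] odd
    by (auto simp: split_set_def)
  ultimately show "local_set (bip_verts k) (bip_diff_matching_edges k) (split_set k A)"
    unfolding local_set_def by (metis Un_empty image_is_empty)
next
  fix L
  assume "local_set (bip_verts k) (bip_diff_matching_edges k) L \<and> L \<subseteq> split_set k A"
  then obtain D where "L \<noteq> {}" and sub: "L \<subseteq> split_set k A" and D: "D \<subseteq> bip_verts k"
    and L: "L = D \<union> odd_neighborhood (bip_verts k) (bip_diff_matching_edges k) D"
    unfolding local_set_def by blast
  define B where "B = Inl -` D"
  define C where "C = Inr -` D"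
  have D_eq: "D = Inl ` B \<union> Inr ` C"
    unfolding B_def C_def by (auto simp: image_iff) (metis sum.exhaust)
  have B: "B \<subseteq> {..<k}" and C: "C \<subseteq> {..<k}"
    using D unfolding B_def C_def bip_verts_def by auto
  note L_eq = L[unfolded D_eq odd_neighborhood_bip_diff_matching[OF B C]]
  have BA: "B \<subseteq> A" and CA: "C \<inter> A = {}"
    using sub by (auto simp: L_eq split_set_def)
  have u_mem: "i \<in> A" if "i < k" "odd (card C) \<longleftrightarrow> i \<notin> C" for i
    using sub that by (auto simp: L_eq split_set_def)
  \<comment> \<open>The premises put \<open>Inr j\<close> into the odd neighborhood, hence into
    \<open>split_set k A\<close>.\<close>
  have v_mem: "j \<notin> A" if "j < k" "odd (card B) \<longleftrightarrow> j \<notin> B" for j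
    using sub that by (auto simp: L_eq split_set_def)
  \<comment> \<open>For even \<open>card B\<close>, \<open>v_mem\<close> makes \<open>B\<close>
    disjoint from \<open>A\<close>, while \<open>BA\<close> places it inside
    \<open>A\<close>.\<close>
  have B_even: "B = {}" if "even (card B)"
    using that v_mem B BA by blast
  have C_even: "C = {}" if "even (card C)"
    using that u_mem C CA by blast
  \<comment> \<open>For odd \<open>card B\<close>, \<open>v_mem\<close> excludes from
    \<open>A\<close> every index outside \<open>B\<close>, so \<open>A\<close> is contained in
    \<open>B\<close>.\<close>
  have B_odd: "B = A" if "odd (card B)"
    using that v_mem A BA by blast
  have C_odd: "C = {..<k} - A" if "odd (card C)"
    using that u_mem C CA by blast
  have "odd (card B) \<or> odd (card C)"
  proof (rule ccontr)
    assume "\<not> ?thesis"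
    then have "B = {}" "C = {}"
      using B_even C_even by auto
    then show False
      using \<open>L \<noteq> {}\<close> by (simp add: L_eq)
  qed
  then have "split_set k A \<subseteq> L"
  proof
    assume "odd (card B)"
    with B_odd show ?thesis
      by (auto simp: L_eq split_set_def)
  next
    \<comment> \<open>Here \<open>D\<close> supplies the \<open>Inr\<close> half, and its odd
      neighborhood supplies \<open>Inl i\<close> for every \<open>i\<close> outside
      \<open>C\<close>, that is, in \<open>A\<close>.\<close>
    assume "odd (card C)"
    with C_odd A show ?thesis
      by (auto simp: L_eq split_set_def)
  qed
  with sub show "L = split_set k A"
    by blast
qed

lemma inj_split_set: "inj (split_set k)"
proof (rule injI)
  fix A B assume "split_set k A = split_set k B"
  moreover have "Inl -` split_set k X = X" for X
    by (auto simp: split_set_def)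
  ultimately show "A = B"
    by metis
qed

lemma card_odd_subsets_ge:
  fixes k :: nat
  assumes "k \<ge> 1"
  shows "2 ^ (k - 1) \<le> card {A. A \<subseteq> {..<k} \<and> odd (card A)}"
proof -
  \<comment> \<open>The last index is used to correct the parity.\<close>
  define f where "f A = (if odd (card A) then A else insert (k - 1) A)" for A
  \<comment> \<open>Intersecting with \<open>{..<k - 1}\<close> drops the index that
    \<open>f\<close> may have added, so it is a left inverse of \<open>f\<close>.\<close>
  have f_restrict: "f A \<inter> {..<k - 1} = A" if "A \<subseteq> {..<k - 1}" for A
    using that by (auto simp: f_def)
  then have "inj_on f (Pow {..<k - 1})"
    by (metis PowD inj_onI)
  moreover have "f ` Pow {..<k - 1} \<subseteq> {A. A \<subseteq> {..<k} \<and> odd (card A)}"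
  proof (clarify, intro conjI)
    fix A assume A: "A \<subseteq> {..<k - 1}"
    then have "finite A" "k - 1 \<notin> A"
      using finite_subset by blast+
    then show "odd (card (f A))"
      by (simp add: f_def)
    show "f A \<subseteq> {..<k}"
      using A assms by (auto simp: f_def split: if_splits)
  qed
  moreover have "finite {A. A \<subseteq> {..<k} \<and> odd (card A)}"
    by (rule finite_subset[of _ "Pow {..<k}"]) auto
  ultimately have "card (Pow {..<k - 1}) \<le> card {A. A \<subseteq> {..<k} \<and> odd (card A)}"
    by (rule card_inj_on_le)
  then show ?thesis
    by (simp add: card_Pow)
qed

theorem mainTheorem6:
  fixes k :: nat
  assumes "k \<ge> 1"
  shows "card (bip_verts k) = 2 * k \<and>
    card {L. minimal_local_set (bip_verts k) (bip_diff_matching_edges k) L} \<ge> 2 ^ (k - 1)"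
proof
  show "card (bip_verts k) = 2 * k"
    unfolding bip_verts_def by (subst card_Un_disjoint) (auto simp: card_image)
next
  let ?M = "{L. minimal_local_set (bip_verts k) (bip_diff_matching_edges k) L}"
  \<comment> \<open>Finiteness matters because \<open>card\<close> of an infinite set is 0, so an
    injection into \<open>?M\<close> alone would give no lower bound.\<close>
  have "?M \<subseteq> Pow (bip_verts k)"
    by (auto simp: minimal_local_set_def local_set_def odd_neighborhood_def)
  then have "finite ?M"
    by (rule finite_subset) (simp add: bip_verts_def)
  moreover have "split_set k ` {A. A \<subseteq> {..<k} \<and> odd (card A)} \<subseteq> ?M"
    using minimal_local_set_split_set by auto
  ultimately have "card {A. A \<subseteq> {..<k} \<and> odd (card A)} \<le> card ?M"
    by (meson card_inj_on_le inj_on_subset inj_split_set subset_UNIV)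
  with card_odd_subsets_ge[OF assms] show "2 ^ (k - 1) \<le> card ?M"
    by linarith
qed

end
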